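(* Assume that the potential $f$ is decreasing and logarithmically convex on $(0,1/2]$. Let $X\subset\mathbb T^d$ be an $N$-point integration lattice, and let $Y\subset\mathbb T^d$ be an $N$-point configuration with the same permutation type as $X$. Then $$E_F(Y)\ge E_F(X).$$
   Context: $\mathbb T=\mathbb R/\mathbb Z$ is identified with $[0,1)$. A potential $f$ on $\mathbb T$ is viewed as a nonnegative even $1$-periodic function on $\mathbb R$, continuous on $(0,1)$; moreover either $f$ is continuous on all of $\mathbb R$, or it is singular at $0$, i.e. $\lim_{t\to0}f(t)=+\infty$ and $f(0)=+\infty$. "Decreasing" means non-increasing; logarithmically convex means $f>0$ and $\log f$ is convex. Energy: $F(t_1,\dots,t_d)=f(t_1)\cdots f(t_d)$ and, for a (multi)set $X=\{\mathbf x^0,\dots,\mathbf x^{N-1}\}\subset\mathbb T^d$, $E_F(X)=\sum_{k,\ell=0,\,k\ne\ell}^{N-1}\prod_{i=1}^d f(x_i^k-x_i^\ell)$. Permutation type: for a configuration $\{\mathbf x^0,\dots,\mathbf x^{N-1}\}\subset\mathbb T^d\simeq[0,1)^d$, a $d$-tuple $(\sigma_1,\dots,\sigma_d)$ of permutations of $\{0,\dots,N-1\}$ is a permutation type if $x_i^{\sigma_i^{-1}(0)}\le x_i^{\sigma_i^{-1}(1)}\le\dots\le x_i^{\sigma_i^{-1}(N-1)}$ for all $i$; points are labelled in order of their first coordinate, so that $\sigma_1=\mathrm{id}$. "$Y$ has the same permutation type as $X$" means that the permutation type of $X$ is a permutation type of $Y$. Integration lattice: a set of the form $\left\{\left(\frac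 kN,\left\{\frac{h_2k}N\right\},\dots,\left\{\frac{h_dk}N\right\}\right):k=0,\dots,N-1\right\}$ with integers $h_i$ satisfying $\gcd(h_i,N)=1$ ($\{\cdot\}$ the fractional part). *)

theory Defs
  imports "HOL-Analysis.Analysis" "HOL-Combinatorics.Permutations"
begin

text \<open>Values lie in \<open>[0, \<infinity>]\<close>, which accommodates \<open>f 0 = \<infinity>\<close>
  for singular potentials.\<close>

definition potential :: "(real \<Rightarrow> ennreal) \<Rightarrow> bool" where
  "potential f \<longleftrightarrow>
     (\<forall>t. f (- t) = f t) \<and>
     (\<forall>t. f (t + 1) = f t) \<and>
     (\<forall>t\<in>{0<..<1}. f t < \<infinity>) \<and>
     continuous_on {0<..<1} f \<and>
     ((f 0 < \<infinity> \<and> continuous_on UNIV f) \<or> (f 0 = \<infinity> \<and> (f \<longlongrightarrow> \<infinity>) (at 0)))"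

text \<open>Meaningful only where \<open>f\<close> is finite, because of \<^const>\<open>enn2real\<close>;
  for potentials this holds on \<open>(0, 1/2]\<close>.\<close>

definition log_convex_on :: "real set \<Rightarrow> (real \<Rightarrow> ennreal) \<Rightarrow> bool" where
  "log_convex_on S f \<longleftrightarrow>
     (\<forall>t\<in>S. 0 < f t) \<and> convex_on S (\<lambda>t. ln (enn2real (f t)))"

text \<open>The torus is identified with \<open>[0,1)\<^sup>d\<close>, with coordinates indexed by \<open>1, \<dots>, d\<close>.\<close>

definition torus :: "nat \<Rightarrow> (nat \<Rightarrow> real) set" where
  "torus d = ({1..d} \<rightarrow>\<^sub>E {0..<1})"

text \<open>An \<open>N\<close>-point configuration, which may contain repeated points, is represented by a
  labelling \<open>x 0, \<dots>, x (N - 1)\<close> in arbitrary order; \<open>x k i\<close> is the \<open>i\<close>-th coordinate of the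
  \<open>k\<close>-th point. The notions below do not depend on the choice of the labelling.\<close>

definition configuration :: "nat \<Rightarrow> nat \<Rightarrow> (nat \<Rightarrow> nat \<Rightarrow> real) \<Rightarrow> bool" where
  "configuration d N x \<longleftrightarrow> (\<forall>k<N. x k \<in> torus d)"

definition energy :: "(real \<Rightarrow> ennreal) \<Rightarrow> nat \<Rightarrow> nat \<Rightarrow> (nat \<Rightarrow> nat \<Rightarrow> real) \<Rightarrow> ennreal" where
  "energy f d N x = (\<Sum>k<N. \<Sum>l\<in>{..<N} - {k}. \<Prod>i=1..d. f (x k i - x l i))"

text \<open>The permutation \<open>\<pi>\<close> relabels the points in order of their first coordinate, as
  \<open>\<sigma> 1 = id\<close> requires.\<close>

definition permutation_type ::
    "nat \<Rightarrow> nat \<Rightarrow> (nat \<Rightarrow> nat \<Rightarrow> real) \<Rightarrow> (nat \<Rightarrow> nat \<Rightarrow> nat) \<Rightarrow> bool" where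
  "permutation_type d N x \<sigma> \<longleftrightarrow>
     \<sigma> 1 = id \<and> (\<forall>i\<in>{1..d}. \<sigma> i permutes {..<N}) \<and>
     (\<exists>\<pi>. \<pi> permutes {..<N} \<and>
        (\<forall>i\<in>{1..d}. mono_on {..<N} (\<lambda>m. x (\<pi> (inv (\<sigma> i) m)) i)))"

text \<open>The permutation type \<open>(\<sigma> 1, \<dots>, \<sigma> d)\<close> of an integration lattice is unique, as its points have pairwise
  distinct \<open>i\<close>-th coordinates for each \<open>i\<close>; so for a lattice \<open>x\<close> this says that the
  permutation type of \<open>x\<close> is a permutation type of \<open>y\<close>.\<close>

definition same_permutation_type ::
    "nat \<Rightarrow> nat \<Rightarrow> (nat \<Rightarrow> nat \<Rightarrow> real) \<Rightarrow> (nat \<Rightarrow> nat \<Rightarrow> real) \<Rightarrow> bool" where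
  "same_permutation_type d N x y \<longleftrightarrow>
     (\<exists>\<sigma>. permutation_type d N x \<sigma> \<and> permutation_type d N y \<sigma>)"

definition lattice_points :: "nat \<Rightarrow> nat \<Rightarrow> (nat \<Rightarrow> int) \<Rightarrow> (nat \<Rightarrow> real) set" where
  "lattice_points d N h =
     (\<lambda>k. \<lambda>i\<in>{1..d}. if i = 1 then real k / real N
                       else frac (of_int (h i) * real k / real N)) ` {..<N}"

definition integration_lattice :: "nat \<Rightarrow> nat \<Rightarrow> (nat \<Rightarrow> nat \<Rightarrow> real) \<Rightarrow> bool" where
  "integration_lattice d N x \<longleftrightarrow>
     (\<exists>h. (\<forall>i\<in>{2..d}. gcd (h i) (int N) = 1) \<and> x ` {..<N} = lattice_points d N h)"

end

theory Submission
  imports Defs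
begin

text \<open>Since \<open>log f\<close> is convex and symmetric about \<open>1/2\<close> on \<open>(0,1)\<close>, it has a supporting line
  at every point, that is \<open>f t \<ge> f a * exp (c * (t - a))\<close>. Label the lattice by \<open>\<int>/N\<close> and group
  the ordered pairs of points by the difference \<open>j\<close> of their labels. Within one group the
  representative in \<open>[0,1)\<close> of the difference of the \<open>i\<close>-th coordinates of the lattice points is a
  constant \<open>a i\<close>. For \<open>Y\<close> the corresponding differences \<open>t i l\<close> lie in \<open>[0,1]\<close>, and the permutation
  type forces them to wrap around for the same pairs as in the lattice, so they have average \<open>a i\<close>.
  Multiplying the supporting inequalities over \<open>i\<close>, summing over \<open>l\<close>, and using
  \<open>exp s \<ge> 1 + s\<close>, the first order terms cancel.\<close>

section \<open>Supporting lines for the logarithm of a potential\<close>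

lemma potential_reflect:
  assumes "potential f"
  shows "f (1 - t) = f t"
  using assms unfolding potential_def by (metis minus_diff_eq diff_add_cancel)

text \<open>Convexity is available on the left half only. Because \<open>f\<close> decreases there,
  the slope can be taken nonpositive, so beyond \<open>1/2\<close> the line lies below its value at
  the mirror point \<open>1 - t\<close>. The endpoints \<open>0\<close> and \<open>1\<close> are
  included because coordinates of \<open>Y\<close> may coincide.\<close>

lemma potential_support_left:
  assumes pot: "potential f" and anti: "antimono_on {0<..1/2} f"
    and lc: "log_convex_on {0<..1/2} f" and a: "a \<in> {0<..1/2}"
  shows "\<exists>c. \<forall>t\<in>{0..1}. f a * ennreal (exp (c * (t - a))) \<le> f t"
proof -
  define g where "g = (\<lambda>t. ln (enn2real (f t)))"
  have conv: "convex_on {0<..1/2} g"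
    using lc by (simp add: log_convex_on_def g_def)
  have fg: "f t = ennreal (exp (g t))" if "t \<in> {0<..1/2}" for t
  proof -
    have "f t < \<infinity>" using pot that by (auto simp: potential_def)
    moreover have "0 < f t" using lc that by (auto simp: log_convex_on_def)
    ultimately show ?thesis
      by (simp add: g_def enn2real_positive_iff less_top)
  qed
  have g_anti: "g t \<le> g s" if "s \<in> {0<..1/2}" "t \<in> {0<..1/2}" "s \<le> t" for s t
  proof -
    have "f t \<le> f s" using anti that by (auto simp: monotone_on_def)
    thus ?thesis using that by (simp add: fg)
  qed
  obtain c where c: "c \<le> 0" "\<And>t. t \<in> {0<..1/2} \<Longrightarrow> g a + c * (t - a) \<le> g t"
  proof (cases "a = 1/2")
    \<comment> \<open>The endpoint \<open>1/2\<close> is not interior, but \<open>g\<close> attains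
      its minimum there, so slope \<open>0\<close> works.\<close>
    case True
    show ?thesis by (rule that[of 0]) (use True g_anti in auto)
  next
    case False
    \<comment> \<open>The infimum of the difference quotients to the right of \<open>a\<close> is
      the right derivative of \<open>g\<close> at \<open>a\<close>.\<close>
    define c where "c = Inf ((\<lambda>t. (g a - g t) / (a - t)) ` ({a<..} \<inter> {0<..1/2}))"
    have int: "a \<in> interior {0<..1/2}"
      by (rule interiorI[of "{0<..<1/2}"]) (use a False in auto)
    have le: "g a + c * (t - a) \<le> g t" if "t \<in> {0<..1/2}" for t
      using convex_le_Inf_differential[OF conv int that] by (simp add: c_def)
    have "c * (1/2 - a) \<le> 0"
      using le[of "1/2"] g_anti[of a "1/2"] a by auto
    hence "c \<le> 0" using a False by (auto simp: mult_le_0_iff)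
    thus ?thesis using le that by blast
  qed
  define h where "h = (\<lambda>t. ennreal (exp (g a + c * (t - a))))"
  have h: "f a * ennreal (exp (c * (t - a))) = h t" for t
    using a by (simp add: fg h_def exp_add ennreal_mult)
  have open_le: "h t \<le> f t" if t: "t \<in> {0<..<1}" for t
  proof (cases "t \<le> 1/2")
    case True
    thus ?thesis using t c(2)[of t] by (simp add: h_def fg)
  next
    case False
    have "c * (t - a) \<le> c * ((1 - t) - a)"
      using False c(1) by (intro mult_left_mono_neg) auto
    also have "g a + \<dots> \<le> g (1 - t)" using t False by (intro c(2)) auto
    finally have "h t \<le> f (1 - t)" using t False by (simp add: h_def fg)
    thus ?thesis by (simp add: potential_reflect[OF pot])
  qed
  have "h t \<le> f t" if t: "t \<in> {0..1}" for t
  \<comment> \<open>At \<open>0\<close> and \<open>1\<close> a singular \<open>f\<close> is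
    infinite; a continuous \<open>f\<close> inherits the bound from the open interval.\<close>
  proof (cases "f 0 = \<infinity>")
    case True
    moreover have "f 1 = f 0" using potential_reflect[OF pot, of 0] by simp
    moreover have "t \<in> {0<..<1} \<or> t = 0 \<or> t = 1" using t by auto
    ultimately show ?thesis using open_le by fastforce
  next
    case False
    hence "continuous_on UNIV f" using pot by (auto simp: potential_def)
    moreover have "continuous_on UNIV h" unfolding h_def
      by (intro continuous_on_ennreal continuous_intros)
    ultimately have "closed {t. h t \<le> f t}" by (intro closed_Collect_le)
    hence "closure {0<..<1} \<subseteq> {t. h t \<le> f t}"
      using open_le by (intro closure_minimal) auto
    thus ?thesis using t by auto
  qed
  thus ?thesis by (intro exI[of _ c]) (simp add: h)
qed

lemma potential_support:
  assumes pot: "potential f" and "antimono_on {0<..1/2} f"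
    and "log_convex_on {0<..1/2} f" and a: "a \<in> {0<..<1}"
  shows "\<exists>c. \<forall>t\<in>{0..1}. f a * ennreal (exp (c * (t - a))) \<le> f t"
proof (cases "a \<le> 1/2")
  case True
  thus ?thesis using potential_support_left[OF assms(1-3)] a by auto
next
  case False
  then obtain c where c: "\<forall>t\<in>{0..1}. f (1 - a) * ennreal (exp (c * (t - (1 - a)))) \<le> f t"
    using potential_support_left[OF assms(1-3), of "1 - a"] a by auto
  have "f a * ennreal (exp (- c * (t - a))) \<le> f t" if "t \<in> {0..1}" for t
  proof -
    have "c * ((1 - t) - (1 - a)) = - c * (t - a)" by (simp add: algebra_simps)
    with c[rule_format, of "1 - t"] that show ?thesis
      by (simp add: potential_reflect[OF pot])
  qed
  thus ?thesis by blast
qed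

section \<open>Comparison of the energy contributions of a single shift\<close>

lemma sum_prod_support_le:
  fixes f :: "real \<Rightarrow> ennreal" and a :: "'i \<Rightarrow> real" and t :: "'i \<Rightarrow> 'k \<Rightarrow> real"
  assumes fin: "finite A"
    and supp: "\<And>i. i \<in> I \<Longrightarrow> \<exists>c. \<forall>s\<in>{0..1}. f (a i) * ennreal (exp (c * (s - a i))) \<le> f s"
    and t: "\<And>i l. i \<in> I \<Longrightarrow> l \<in> A \<Longrightarrow> t i l \<in> {0..1}"
    and mean: "\<And>i. i \<in> I \<Longrightarrow> (\<Sum>l\<in>A. t i l) = of_nat (card A) * a i"
  shows "(\<Sum>l\<in>A. \<Prod>i\<in>I. f (a i)) \<le> (\<Sum>l\<in>A. \<Prod>i\<in>I. f (t i l))"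
proof (cases "finite I")
  case finI: True
  obtain c where c: "\<And>i s. i \<in> I \<Longrightarrow> s \<in> {0..1} \<Longrightarrow> f (a i) * ennreal (exp (c i * (s - a i))) \<le> f s"
    using supp by metis
  \<comment> \<open>\<open>s l\<close> is the total exponent in the product for \<open>l\<close>.
    Its sum over \<open>l\<close> vanishes because each slope \<open>c i\<close> is the same for all
    \<open>l\<close>. This cancellation is carried out in the reals, before passing to
    \<open>ennreal\<close>.\<close>
  define s where "s = (\<lambda>l. \<Sum>i\<in>I. c i * (t i l - a i))"
  have "(\<Sum>l\<in>A. s l) = (\<Sum>i\<in>I. c i * (\<Sum>l\<in>A. t i l - a i))"
    unfolding s_def by (subst sum.swap) (simp add: sum_distrib_left)
  also have "\<dots> = 0"
    by (intro sum.neutral) (simp add: sum_subtractf mean)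
  finally have s0: "(\<Sum>l\<in>A. s l) = 0" .
  have "real (card A) = (\<Sum>l\<in>A. 1 + s l)" by (simp add: sum.distrib s0)
  also have "\<dots> \<le> (\<Sum>l\<in>A. exp (s l))" by (intro sum_mono exp_ge_add_one_self)
  finally have card: "ennreal (real (card A)) \<le> (\<Sum>l\<in>A. ennreal (exp (s l)))"
    by (simp add: sum_ennreal ennreal_leI del: ennreal_of_nat_eq_real_of_nat)
  have "(\<Sum>l\<in>A. \<Prod>i\<in>I. f (a i)) = (\<Prod>i\<in>I. f (a i)) * ennreal (real (card A))"
    by (simp add: mult.commute ennreal_of_nat_eq_real_of_nat)
  also have "\<dots> \<le> (\<Prod>i\<in>I. f (a i)) * (\<Sum>l\<in>A. ennreal (exp (s l)))"
    by (intro mult_left_mono card) simp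
  also have "\<dots> = (\<Sum>l\<in>A. \<Prod>i\<in>I. f (a i) * ennreal (exp (c i * (t i l - a i))))"
    by (simp add: sum_distrib_left prod.distrib s_def exp_sum finI prod_ennreal)
  also have "\<dots> \<le> (\<Sum>l\<in>A. \<Prod>i\<in>I. f (t i l))"
    by (intro sum_mono prod_mono_ennreal c t)
  finally show ?thesis .
\<comment> \<open>Over an infinite \<open>I\<close> both products have the default value
  \<open>1\<close>.\<close>
qed simp

text \<open>The hypothesis on \<open>a\<close> says that \<open>a i\<close> is the representative in \<open>[0,1)\<close> of
  \<open>x (\<tau> l) i - x l i\<close>, for every \<open>l\<close>.\<close>

lemma shifted_energy_le:
  fixes f :: "real \<Rightarrow> ennreal" and x y :: "'k \<Rightarrow> 'i \<Rightarrow> real"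
  assumes fin: "finite A" and bij: "bij_betw \<tau> A A" and per: "\<And>t. f (t + 1) = f t"
    and supp: "\<And>i. i \<in> I \<Longrightarrow> \<exists>c. \<forall>s\<in>{0..1}. f (a i) * ennreal (exp (c * (s - a i))) \<le> f s"
    and a: "\<And>i. i \<in> I \<Longrightarrow> a i \<noteq> 0"
      "\<And>i l. i \<in> I \<Longrightarrow> l \<in> A \<Longrightarrow> x (\<tau> l) i - x l i + of_bool (x (\<tau> l) i < x l i) = a i"
    and y: "\<And>i l. i \<in> I \<Longrightarrow> l \<in> A \<Longrightarrow> y l i \<in> {0..<1}"
    and comono: "\<And>i k l. i \<in> I \<Longrightarrow> k \<in> A \<Longrightarrow> l \<in> A \<Longrightarrow> x k i < x l i \<Longrightarrow> y k i \<le> y l i"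
  shows "(\<Sum>l\<in>A. \<Prod>i\<in>I. f (x (\<tau> l) i - x l i)) \<le> (\<Sum>l\<in>A. \<Prod>i\<in>I. f (y (\<tau> l) i - y l i))"
proof -
  \<comment> \<open>The wrap indicator is that of \<open>x\<close>, not of \<open>y\<close>: the
    sums of \<open>t\<close> then agree with those for \<open>x\<close>. The value \<open>1\<close>
    occurs when \<open>x\<close> wraps while the \<open>y\<close> coordinates coincide.\<close>
  define t where "t = (\<lambda>i l. y (\<tau> l) i - y l i + of_bool (x (\<tau> l) i < x l i))"
  have \<tau>: "\<tau> l \<in> A" if "l \<in> A" for l using bij that by (auto simp: bij_betw_def)
  have f_wrap: "f (s + of_bool b) = f s" for s b using per by simp
  have tel: "(\<Sum>l\<in>A. z (\<tau> l) i - z l i) = 0" for z :: "'k \<Rightarrow> 'i \<Rightarrow> real" and i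
    using sum.reindex_bij_betw[OF bij, of "\<lambda>l. z l i"] by (simp add: sum_subtractf)
  have mean: "(\<Sum>l\<in>A. t i l) = of_nat (card A) * a i" if "i \<in> I" for i
  proof -
    have "(\<Sum>l\<in>A. t i l) = (\<Sum>l\<in>A. x (\<tau> l) i - x l i + of_bool (x (\<tau> l) i < x l i))"
      unfolding t_def sum.distrib tel by simp
    thus ?thesis using a(2) that by simp
  qed
  have t01: "t i l \<in> {0..1}" if "i \<in> I" "l \<in> A" for i l
  proof -
    \<comment> \<open>A tie would give \<open>a i = 0\<close>. Without ties \<open>comono\<close>
      always orders the two \<open>y\<close> coordinates.\<close>
    have "x (\<tau> l) i \<noteq> x l i" using a[of i] that by fastforce
    thus ?thesis
      using y[OF that] y[OF that(1) \<tau>[OF that(2)]]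
        comono[OF that(1) \<tau>[OF that(2)] that(2)] comono[OF that \<tau>[OF that(2)]]
      by (cases "x (\<tau> l) i < x l i") (auto simp: t_def)
  qed
  have "(\<Sum>l\<in>A. \<Prod>i\<in>I. f (x (\<tau> l) i - x l i)) = (\<Sum>l\<in>A. \<Prod>i\<in>I. f (a i))"
    by (intro sum.cong prod.cong refl) (metis a(2) f_wrap)
  also have "\<dots> \<le> (\<Sum>l\<in>A. \<Prod>i\<in>I. f (t i l))"
    by (rule sum_prod_support_le[OF fin supp t01 mean])
  also have "\<dots> = (\<Sum>l\<in>A. \<Prod>i\<in>I. f (y (\<tau> l) i - y l i))"
    by (simp add: t_def f_wrap)
  finally show ?thesis .
qed

section \<open>Cyclic shifts modulo \<open>N\<close>\<close>

lemma bij_betw_add_mod: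
  assumes "0 < (N :: nat)"
  shows "bij_betw (\<lambda>l. (l + j) mod N) {..<N} {..<N}"
proof -
  have "inj_on (\<lambda>l. (l + j) mod N) {..<N}"
  proof (rule inj_onI)
    fix k l assume kl: "k \<in> {..<N}" "l \<in> {..<N}" and "(k + j) mod N = (l + j) mod N"
    hence "(int k + int j) mod int N = (int l + int j) mod int N"
      by (metis of_nat_add of_nat_mod)
    hence "int N dvd (int k + int j) - (int l + int j)" by (simp only: mod_eq_dvd_iff)
    hence "int k mod int N = int l mod int N" by (simp add: mod_eq_dvd_iff)
    thus "k = l" using kl by simp
  qed
  thus ?thesis using assms by (simp add: bij_betw_def endo_inj_surj image_subset_iff)
qed

text \<open>For fixed \<open>l\<close>, the nonzero residues \<open>j\<close> correspond bijectively
  to the indices \<open>k\<close> different from \<open>l\<close>, through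
  \<open>k = (l + j) mod N\<close>.\<close>

lemma sum_off_diagonal_shifts:
  fixes G :: "nat \<Rightarrow> nat \<Rightarrow> 'a :: comm_monoid_add"
  assumes "0 < N"
  shows "(\<Sum>k<N. \<Sum>l\<in>{..<N} - {k}. G k l) = (\<Sum>j\<in>{1..<N}. \<Sum>l<N. G ((l + j) mod N) l)"
proof -
  have bij: "bij_betw (\<lambda>j. (l + j) mod N) {1..<N} ({..<N} - {l})" if l: "l < N" for l
  proof -
    have "bij_betw (\<lambda>j. (l + j) mod N) ({..<N} - {0}) ({..<N} - {l})"
      using bij_betw_DiffI[OF bij_betw_add_mod[OF assms, of l], of "{0}" "{l}"] assms l
      by (simp add: add.commute bij_betw_def)
    moreover have "{..<N} - {0} = {1..<N}" by auto
    ultimately show ?thesis by simp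
  qed
  have "(\<Sum>k<N. \<Sum>l\<in>{..<N} - {k}. G k l) = (\<Sum>l<N. \<Sum>k\<in>{..<N} - {l}. G k l)"
    using sum.swap_restrict[of "{..<N}" "{..<N}" G "\<lambda>k l. k \<noteq> l"]
    by (simp add: set_diff_eq eq_commute)
  also have "\<dots> = (\<Sum>l<N. \<Sum>j\<in>{1..<N}. G ((l + j) mod N) l)"
    using bij by (intro sum.cong refl sum.reindex_bij_betw[symmetric]) auto
  also have "\<dots> = (\<Sum>j\<in>{1..<N}. \<Sum>l<N. G ((l + j) mod N) l)" by (rule sum.swap)
  finally show ?thesis .
qed

section \<open>Labellings of configurations and coordinates of the lattice\<close>

lemma energy_relabel:
  assumes \<pi>: "bij_betw \<pi> {..<N} {..<N}"
  shows "energy f d N (\<lambda>k. x (\<pi> k)) = energy f d N x"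
proof -
  define G where "G = (\<lambda>k l. \<Prod>i=1..d. f (x k i - x l i))"
  have "(\<Sum>l\<in>{..<N} - {k}. G (\<pi> k) (\<pi> l)) = (\<Sum>l\<in>{..<N} - {\<pi> k}. G (\<pi> k) l)" if "k < N" for k
    using \<pi> that by (intro sum.reindex_bij_betw bij_betw_DiffI) (auto simp: bij_betw_def)
  moreover have "(\<Sum>k<N. \<Sum>l\<in>{..<N} - {\<pi> k}. G (\<pi> k) l) = (\<Sum>k<N. \<Sum>l\<in>{..<N} - {k}. G k l)"
    by (rule sum.reindex_bij_betw[OF \<pi>])
  ultimately show ?thesis by (simp add: energy_def G_def)
qed

text \<open>\<open>\<sigma> i k\<close> is the rank of point \<open>k\<close> in coordinate
  \<open>i\<close>, common to both configurations. A strict inequality in \<open>x\<close> forces a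
  strict order of ranks, which gives only a weak inequality in \<open>y\<close>, where ties may
  occur.\<close>

lemma same_permutation_type_comonotone:
  assumes "same_permutation_type d N x y"
  obtains \<pi> \<rho> where "\<pi> permutes {..<N}" "\<rho> permutes {..<N}"
    "\<And>i k l. i \<in> {1..d} \<Longrightarrow> k < N \<Longrightarrow> l < N \<Longrightarrow> x (\<pi> k) i < x (\<pi> l) i \<Longrightarrow> y (\<rho> k) i \<le> y (\<rho> l) i"
proof -
  from assms obtain \<sigma> \<pi> \<rho> where \<sigma>: "\<forall>i\<in>{1..d}. \<sigma> i permutes {..<N}"
    and \<pi>: "\<pi> permutes {..<N}" "\<forall>i\<in>{1..d}. mono_on {..<N} (\<lambda>m. x (\<pi> (inv (\<sigma> i) m)) i)"
    and \<rho>: "\<rho> permutes {..<N}" "\<forall>i\<in>{1..d}. mono_on {..<N} (\<lambda>m. y (\<rho> (inv (\<sigma> i) m)) i)"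
    unfolding same_permutation_type_def permutation_type_def by blast
  show ?thesis
  proof (rule that[OF \<pi>(1) \<rho>(1)])
    fix i k l assume i: "i \<in> {1..d}" and kl: "k < N" "l < N" and less: "x (\<pi> k) i < x (\<pi> l) i"
    have \<sigma>i: "\<sigma> i permutes {..<N}" using \<sigma> i by blast
    have inv: "inv (\<sigma> i) (\<sigma> i m) = m" for m using permutes_inverses(2)[OF \<sigma>i] .
    have N: "\<sigma> i k \<in> {..<N}" "\<sigma> i l \<in> {..<N}" using permutes_in_image[OF \<sigma>i] kl by auto
    have "\<not> \<sigma> i l \<le> \<sigma> i k"
      using mono_onD[OF \<pi>(2)[rule_format, OF i] N(2,1)] less by (auto simp: inv)
    thus "y (\<rho> k) i \<le> y (\<rho> l) i"
      using mono_onD[OF \<rho>(2)[rule_format, OF i] N] by (auto simp: inv)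
  qed
qed

text \<open>The lattice is given as a set, so its labelling by residues has to be recovered. The
  first coordinate separates the points \<open>L k\<close>; hence \<open>x\<close> maps onto a set
  of \<open>N\<close> points and is injective.\<close>

lemma integration_lattice_relabel:
  assumes N: "0 < N" and d: "1 \<le> d" and "integration_lattice d N x"
  obtains \<pi> h where "bij_betw \<pi> {..<N} {..<N}" "\<And>i. i \<in> {1..d} \<Longrightarrow> coprime (h i) (int N)"
    "\<And>i k. i \<in> {1..d} \<Longrightarrow> k < N \<Longrightarrow> x (\<pi> k) i = frac (of_int (h i) * real k / real N)"
proof -
  from assms obtain h where h: "\<forall>i\<in>{2..d}. gcd (h i) (int N) = 1"
    and im: "x ` {..<N} = lattice_points d N h"
    unfolding integration_lattice_def by blast
  define L where "L = (\<lambda>k. \<lambda>i\<in>{1..d}. if i = 1 then real k / real N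
                       else frac (of_int (h i) * real k / real N))"
  have im: "x ` {..<N} = L ` {..<N}" using im by (simp add: lattice_points_def L_def)
  have injL: "inj_on L {..<N}"
  proof (rule inj_onI)
    fix k l assume "L k = L l"
    hence "L k 1 = L l 1" by simp
    thus "k = l" using N d by (simp add: L_def)
  qed
  have "card (x ` {..<N}) = card {..<N}" using card_image[OF injL] im by simp
  hence injx: "inj_on x {..<N}" by (simp add: eq_card_imp_inj_on)
  define \<pi> where "\<pi> = (\<lambda>k. the_inv_into {..<N} x (L k))"
  have bij: "bij_betw \<pi> {..<N} {..<N}"
    using bij_betw_trans[of L "{..<N}" "L ` {..<N}" "the_inv_into {..<N} x" "{..<N}"]
      bij_betw_the_inv_into[of x "{..<N}" "L ` {..<N}"] injL injx im
    by (simp add: bij_betw_def \<pi>_def comp_def)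
  have x\<pi>: "x (\<pi> k) = L k" if "k < N" for k
    unfolding \<pi>_def using im that by (intro f_the_inv_into_f[OF injx]) auto
  show ?thesis
  \<comment> \<open>With multiplier \<open>1\<close> the first coordinate takes the same form as the
    others, since \<open>k / N\<close> is its own fractional part for \<open>k < N\<close>.\<close>
  proof (rule that[OF bij, of "h(1 := 1)"])
    show "coprime ((h(1 := 1)) i) (int N)" if "i \<in> {1..d}" for i
      using h that by (auto simp: coprime_iff_gcd_eq_1)
    show "x (\<pi> k) i = frac (of_int ((h(1 := 1)) i) * real k / real N)"
      if "i \<in> {1..d}" "k < N" for i k
      using that by (auto simp: x\<pi> L_def frac_eq)
  qed
qed

text \<open>The left side differs from \<open>u - v\<close> by an integer and lies in
  \<open>[0,1)\<close>. This is the form of the hypothesis on \<open>a\<close> in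
  \<open>shifted_energy_le\<close>.\<close>

lemma frac_diff_wrap:
  fixes u v :: real
  shows "frac u - frac v + of_bool (frac u < frac v) = frac (u - v)"
proof (rule sym, unfold frac_unique_iff, intro conjI)
  show "u - v - (frac u - frac v + of_bool (frac u < frac v)) \<in> \<int>"
    by (simp add: frac_def)
qed (smt (verit) frac_lt_1 frac_ge_0 of_bool_def)+

text \<open>Reducing \<open>l + j\<close> modulo \<open>N\<close> changes the argument by an integer
  multiple of \<open>h\<close>, so the result is independent of \<open>l\<close>.\<close>

lemma frac_lattice_diff:
  fixes h :: int
  assumes "0 < N"
  shows "frac (of_int h * real ((l + j) mod N) / real N - of_int h * real l / real N)
           = frac (of_int h * real j / real N)"
proof -
  define q where "q = (l + j) div N"
  have "(l + j) mod N + N * q = l + j" unfolding q_def by (rule mod_mult_div_eq)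
  hence *: "real ((l + j) mod N) = real l + real j - real N * real q"
    by (metis add_diff_cancel_right' of_nat_add of_nat_mult)
  have "of_int h * real ((l + j) mod N) / real N - of_int h * real l / real N
      = of_int h * real j / real N + of_int (- h * int q)"
    unfolding * using assms by (simp add: field_simps)
  moreover have "frac (s + of_int m) = frac s" for s :: real and m
    by (simp add: frac_def)
  ultimately show ?thesis by metis
qed

theorem corollary4p3:
  fixes f :: "real \<Rightarrow> ennreal" and d N :: nat and X Y :: "nat \<Rightarrow> nat \<Rightarrow> real"
  assumes "1 \<le> d" and "1 \<le> N"
    and "potential f"
    and "antimono_on {0<..1/2} f"
    and "log_convex_on {0<..1/2} f"
    and "configuration d N X" and "integration_lattice d N X"
    and "configuration d N Y" and "same_permutation_type d N X Y"
  shows "energy f d N Y \<ge> energy f d N X"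
proof -
  have N: "0 < N" using assms(2) by simp
  obtain \<pi> \<rho> where \<pi>: "\<pi> permutes {..<N}" and \<rho>: "\<rho> permutes {..<N}"
    and comono: "\<And>i k l. i \<in> {1..d} \<Longrightarrow> k < N \<Longrightarrow> l < N \<Longrightarrow> X (\<pi> k) i < X (\<pi> l) i
      \<Longrightarrow> Y (\<rho> k) i \<le> Y (\<rho> l) i"
    using same_permutation_type_comonotone[OF assms(9)] by blast
  obtain \<theta> h where \<theta>: "bij_betw \<theta> {..<N} {..<N}"
    and h: "\<And>i. i \<in> {1..d} \<Longrightarrow> coprime (h i) (int N)"
    and X\<theta>: "\<And>i k. i \<in> {1..d} \<Longrightarrow> k < N \<Longrightarrow> X (\<theta> k) i = frac (of_int (h i) * real k / real N)"
    using integration_lattice_relabel[OF N assms(1,7)] by blast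
  \<comment> \<open>\<open>\<theta>\<close> picks a lattice point by its residue,
    \<open>inv \<pi>\<close> finds its index in the labelling shared with \<open>Y\<close>, and
    \<open>\<rho>\<close> picks the partner in \<open>Y\<close>.\<close>
  define \<omega> where "\<omega> = \<rho> \<circ> inv \<pi> \<circ> \<theta>"
  have \<omega>: "bij_betw \<omega> {..<N} {..<N}" unfolding \<omega>_def
    using \<theta> permutes_imp_bij[OF \<rho>] permutes_imp_bij[OF permutes_inv[OF \<pi>]]
    by (blast intro: bij_betw_trans)
  define x where "x = (\<lambda>k. X (\<theta> k))"
  define y where "y = (\<lambda>k. Y (\<omega> k))"
  have xy: "y k i \<le> y l i" if "i \<in> {1..d}" "k < N" "l < N" "x k i < x l i" for i k l
  proof -
    have "inv \<pi> (\<theta> m) < N" if "m < N" for m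
      using permutes_in_image[OF permutes_inv[OF \<pi>], of "\<theta> m"] \<theta> that by (auto simp: bij_betw_def)
    moreover have "\<pi> (inv \<pi> (\<theta> m)) = \<theta> m" for m using permutes_inverses(1)[OF \<pi>] .
    ultimately show ?thesis
      using comono[of i "inv \<pi> (\<theta> k)" "inv \<pi> (\<theta> l)"] that by (simp add: x_def y_def \<omega>_def)
  qed
  have y01: "y k i \<in> {0..<1}" if "i \<in> {1..d}" "k < N" for i k
  proof -
    have "\<omega> k < N" using \<omega> that by (auto simp: bij_betw_def)
    thus ?thesis using assms(8) that by (auto simp: configuration_def torus_def y_def PiE_iff)
  qed
  have per: "f (t + 1) = f t" for t using assms(3) by (simp add: potential_def)
  have shift: "(\<Sum>l<N. \<Prod>i=1..d. f (x ((l + j) mod N) i - x l i))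
      \<le> (\<Sum>l<N. \<Prod>i=1..d. f (y ((l + j) mod N) i - y l i))" if j: "j \<in> {1..<N}" for j
  proof (rule shifted_energy_le[where a = "\<lambda>i. frac (of_int (h i) * real j / real N)"])
    fix i assume i: "i \<in> {1..d}"
    \<comment> \<open>Coprimality and \<open>0 < j < N\<close> keep the lattice difference away from
      \<open>0\<close>, hence inside \<open>(0,1)\<close>, where a supporting line exists.\<close>
    have "\<not> int N dvd h i * int j"
      using h[OF i] j by (auto simp: coprime_dvd_mult_right_iff coprime_commute dest: zdvd_imp_le)
    moreover have "int N dvd h i * int j" if "of_int (h i) * real j / real N \<in> \<int>"
    proof -
      from that obtain m where "of_int (h i) * real j / real N = of_int m" by (auto elim: Ints_cases)
      hence "real_of_int (h i * int j) = real_of_int (int N * m)"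
        using N by (simp add: field_simps)
      thus ?thesis by (metis dvd_triv_left of_int_eq_iff)
    qed
    ultimately show nz: "frac (of_int (h i) * real j / real N) \<noteq> 0"
      by (auto simp: frac_eq_0_iff)
    show "\<exists>c. \<forall>s\<in>{0..1}. f (frac (of_int (h i) * real j / real N))
        * ennreal (exp (c * (s - frac (of_int (h i) * real j / real N)))) \<le> f s"
      using nz frac_lt_1[of "of_int (h i) * real j / real N"]
      by (intro potential_support assms(3-5)) (simp add: frac_gt_0_iff)
    show "x ((l + j) mod N) i - x l i + of_bool (x ((l + j) mod N) i < x l i)
        = frac (of_int (h i) * real j / real N)" if "l \<in> {..<N}" for l
      using that i N j by (simp add: x_def X\<theta> frac_diff_wrap frac_lattice_diff)
  next
    show "bij_betw (\<lambda>l. (l + j) mod N) {..<N} {..<N}" by (rule bij_betw_add_mod[OF N])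
  qed (simp_all add: per xy y01[simplified])
  have "energy f d N X = energy f d N x"
    unfolding x_def by (rule energy_relabel[OF \<theta>, symmetric])
  also have "\<dots> \<le> energy f d N y"
    unfolding energy_def sum_off_diagonal_shifts[OF N] by (intro sum_mono shift)
  also have "\<dots> = energy f d N Y"
    unfolding y_def by (rule energy_relabel[OF \<omega>])
  finally show ?thesis .
qed

end
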